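(* Let $L>0$, $f\in\mathcal F^1_L$, $s>0$, and let $\{x_k\},\{y_k\},\{z_k\}$ be the iterates of algorithm $(\mathcal B')$ (defined in the context). Then for each $k\ge1$ such that $\alpha_k\ge1$ and $\widetilde\alpha_k\ge0$, $$\alpha_k\widetilde\alpha_ks(f(x_k)-f^* )-\frac{\widetilde\alpha_k^2s^2}{2}\|\nabla f(x_k)\|^2+\frac12\|z_{k+1}-x^*\|^2$$ $$\le\widetilde\alpha_k(\alpha_k-1)s\Big((f(x_{k-1})-f^* )-\frac{(2-\beta_{k-1}Ls)\beta_{k-1}s}{2}\|\nabla f(x_{k-1})\|^2\Big)+\frac12\|z_k-x^*\|^2.$$
   Context: $\mathcal F^1_L$ is the set of continuously differentiable convex functions $f:\mathbb R^n\to\mathbb R$ that are $L$-smooth ($\|\nabla f(y)-\nabla f(x)\|\le L\|y-x\|$ for all $x,y$, Euclidean norm). It is assumed throughout that $f$ has a minimizer; $x^*$ denotes one of the minimizers and $f^*=f(x^* )$. Algorithm $(\mathcal B')$: given real sequences $\{\alpha_k\}_{k\ge0}$ (nonzero, so that the recursion is defined), $\{\beta_k\}_{k\ge0}$, $\{\gamma_k\}_{k\ge0}$, put $\widetilde\alpha_k=\beta_k\alpha_k+(\gamma_k-\beta_k)\alpha_{k+1}$; starting from $x_0=z_0\in\mathbb R^n$, for $k\ge0$, $$y_{k+1}=x_k-\beta_ks\nabla f(x_k),\qquad z_{k+1}=z_k-\widetilde\alpha_ks\nabla f(x_k),\qquad x_{k+1}=\frac1{\alpha_{k+1}}z_{k+1}+\Big(1-\frac1{\alpha_{k+1}}\Big)y_{k+1}.$$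 *)

theory Defs
  imports "HOL-Analysis.Analysis"
begin

definition grad :: "('a::real_inner \<Rightarrow> real) \<Rightarrow> 'a \<Rightarrow> 'a" where
  "grad f x = (THE D. GDERIV f x :> D)"

lemma grad_eqI:
  assumes "GDERIV f x :> D"
  shows "grad f x = D"
  unfolding grad_def
proof (rule the_equality)
  fix D' assume "GDERIV f x :> D'"
  with assms have "(\<lambda>h. inner h D) = (\<lambda>h. inner h D')"
    unfolding gderiv_def by (rule has_derivative_unique)
  then have "inner h D = inner h D'" for h by metis
  then have "inner h (D' - D) = 0" for h by (simp add: inner_diff_right)
  then have "D' - D = 0" using inner_eq_zero_iff by blast
  then show "D' = D" by simp
qed (rule assms)

lemma GDERIV_grad:
  fixes f :: "'a::euclidean_space \<Rightarrow> real"
  assumes "f differentiable (at x)"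
  shows "GDERIV f x :> grad f x"
proof -
  obtain f' where f': "(f has_derivative f') (at x)"
    using assms by (auto simp: differentiable_def)
  interpret bounded_linear f' using f' by (rule has_derivative_bounded_linear)
  have "f' = (\<lambda>h. inner h (adjoint f' 1))"
    using adjoint_works[OF linear_axioms, of _ 1] by (auto simp: inner_commute)
  with f' have "GDERIV f x :> adjoint f' 1"
    unfolding gderiv_def by simp
  then show ?thesis using grad_eqI by metis
qed

definition F1 :: "real \<Rightarrow> (real ^ 'n \<Rightarrow> real) set" where
  "F1 L = {f. (\<forall>x. f differentiable (at x)) \<and> continuous_on UNIV (grad f) \<and>
              convex_on UNIV f \<and>
              (\<forall>x y. norm (grad f y - grad f x) \<le> L * norm (y - x))}"

definition tilde_alpha ::
  "(nat \<Rightarrow> real) \<Rightarrow> (nat \<Rightarrow> real) \<Rightarrow> (nat \<Rightarrow> real) \<Rightarrow> nat \<Rightarrow> real" where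
  "tilde_alpha \<alpha> \<beta> \<gamma> k = \<beta> k * \<alpha> k + (\<gamma> k - \<beta> k) * \<alpha> (k + 1)"

text \<open>The value \<open>y 0\<close> is unconstrained: the algorithm only produces \<open>y k\<close> for \<open>k \<ge> 1\<close>.\<close>

definition alg_B' ::
  "(real ^ 'n \<Rightarrow> real) \<Rightarrow> real \<Rightarrow> (nat \<Rightarrow> real) \<Rightarrow> (nat \<Rightarrow> real) \<Rightarrow> (nat \<Rightarrow> real) \<Rightarrow>
   (nat \<Rightarrow> real ^ 'n) \<Rightarrow> (nat \<Rightarrow> real ^ 'n) \<Rightarrow> (nat \<Rightarrow> real ^ 'n) \<Rightarrow> bool" where
  "alg_B' f s \<alpha> \<beta> \<gamma> x y z \<longleftrightarrow>
     x 0 = z 0 \<and>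
     (\<forall>k. y (k + 1) = x k - (\<beta> k * s) *\<^sub>R grad f (x k) \<and>
          z (k + 1) = z k - (tilde_alpha \<alpha> \<beta> \<gamma> k * s) *\<^sub>R grad f (x k) \<and>
          x (k + 1) = (1 / \<alpha> (k + 1)) *\<^sub>R z (k + 1) + (1 - 1 / \<alpha> (k + 1)) *\<^sub>R y (k + 1))"

end

theory Submission
  imports Defs
begin

text \<open>
  Convexity at \<open>x\<^sub>k\<close>, tested against \<open>x\<^sup>*\<close> and against \<open>y\<^sub>k\<close> with weights \<open>1\<close> and \<open>\<alpha>\<^sub>k - 1\<close>, gives
  \<open>\<alpha>\<^sub>k f(x\<^sub>k) - f\<^sup>* - (\<alpha>\<^sub>k - 1) f(y\<^sub>k) \<le> \<langle>\<nabla>f(x\<^sub>k), z\<^sub>k - x\<^sup>*\<rangle>\<close>, because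
  \<open>z\<^sub>k - x\<^sup>* = (x\<^sub>k - x\<^sup>*) + (\<alpha>\<^sub>k - 1)(x\<^sub>k - y\<^sub>k)\<close>. The inner product is what appears when
  \<open>\<parallel>z\<^sub>k\<^sub>+\<^sub>1 - x\<^sup>*\<parallel>\<^sup>2\<close> is expanded, and \<open>f(y\<^sub>k)\<close> is bounded by the descent lemma, since \<open>y\<^sub>k\<close> is a
  gradient step from \<open>x\<^sub>k\<^sub>-\<^sub>1\<close>.
\<close>

lemma GDERIV_along_line:
  fixes f :: "'a::real_inner \<Rightarrow> real"
  assumes "GDERIV f (x + t *\<^sub>R d) :> D"
  shows "((\<lambda>u. f (x + u *\<^sub>R d)) has_real_derivative D \<bullet> d) (at t)"
proof -
  have "((\<lambda>u. x + u *\<^sub>R d) has_derivative (\<lambda>h. h *\<^sub>R d)) (at t)"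
    by (auto intro!: derivative_eq_intros)
  from diff_chain_at[OF this assms[unfolded gderiv_def]]
  show ?thesis
    by (simp add: has_field_derivative_def o_def inner_commute mult_commute_abs)
qed

text \<open>Restricting \<open>f\<close> to the line through \<open>x\<close> and \<open>y\<close>
  reduces this to the tangent inequality in one real variable, between the parameters 0 and
  1.\<close>

lemma convex_on_GDERIV_above_tangent:
  fixes f :: "'a::real_inner \<Rightarrow> real"
  assumes conv: "convex_on UNIV f" and D: "GDERIV f x :> D"
  shows "f x + D \<bullet> (y - x) \<le> f y"
proof -
  let ?p = "\<lambda>t. f (x + t *\<^sub>R (y - x))"
  have "convex_on UNIV ?p"
  proof (rule convex_onI)
    fix t a b :: real assume t: "0 < t" "t < 1"
    have "x + ((1 - t) *\<^sub>R a + t *\<^sub>R b) *\<^sub>R (y - x)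
        = (1 - t) *\<^sub>R (x + a *\<^sub>R (y - x)) + t *\<^sub>R (x + b *\<^sub>R (y - x))"
      by (simp add: algebra_simps)
    then show "?p ((1 - t) *\<^sub>R a + t *\<^sub>R b) \<le> (1 - t) * ?p a + t * ?p b"
      using convex_onD[OF conv, of t] t by simp
  qed simp
  moreover have "(?p has_real_derivative D \<bullet> (y - x)) (at 0)"
    using D by (intro GDERIV_along_line) simp
  ultimately have "?p 1 - ?p 0 \<ge> D \<bullet> (y - x) * (1 - 0)"
    by (intro convex_on_imp_above_tangent[where A = UNIV]) auto
  then show ?thesis by simp
qed

text \<open>By Cauchy-Schwarz and the Lipschitz bound, the slope of \<open>f\<close> along the
  segment exceeds its initial value by at most a term linear in the parameter. A monotonicity
  argument takes the place of integrating this.\<close>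

lemma smooth_quadratic_upper_bound:
  fixes f :: "'a::real_inner \<Rightarrow> real"
  assumes D: "\<And>x. GDERIV f x :> g x"
    and lip: "\<And>x y. norm (g y - g x) \<le> L * norm (y - x)"
  shows "f y \<le> f x + g x \<bullet> (y - x) + L / 2 * (norm (y - x))\<^sup>2"
proof -
  define d where "d = y - x"
  \<comment> \<open>Subtracting the linear and quadratic terms of the bound makes
    \<open>p 1 \<le> p 0\<close> the claim.\<close>
  define p where "p t = f (x + t *\<^sub>R d) - t * (g x \<bullet> d) - L / 2 * t\<^sup>2 * (norm d)\<^sup>2" for t
  have "p 1 \<le> p 0"
  proof (rule DERIV_nonpos_imp_nonincreasing[where f = p])
    fix t :: real assume t: "0 \<le> t" "t \<le> 1"
    have "(p has_real_derivative
        g (x + t *\<^sub>R d) \<bullet> d - g x \<bullet> d - L * t * (norm d)\<^sup>2) (at t)"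
      unfolding p_def
      by (rule derivative_eq_intros GDERIV_along_line D refl | simp)+
    moreover have "g (x + t *\<^sub>R d) \<bullet> d - g x \<bullet> d - L * t * (norm d)\<^sup>2 \<le> 0"
    proof -
      have "(g (x + t *\<^sub>R d) - g x) \<bullet> d \<le> norm (g (x + t *\<^sub>R d) - g x) * norm d"
        by (rule norm_cauchy_schwarz)
      also have "\<dots> \<le> (L * norm (x + t *\<^sub>R d - x)) * norm d"
        by (intro mult_right_mono lip) simp
      also have "\<dots> = L * t * (norm d)\<^sup>2"
        using t by (simp add: power2_eq_square)
      finally show ?thesis by (simp add: inner_diff_left)
    qed
    ultimately show "\<exists>D. (p has_real_derivative D) (at t) \<and> D \<le> 0" by blast
  qed simp
  then show ?thesis by (simp add: p_def d_def)
qed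

text \<open>The step \<open>t\<close> may have any sign, as may the step sizes \<beta>.\<close>

lemma gradient_step_descent:
  fixes f :: "'a::real_inner \<Rightarrow> real"
  assumes "\<And>x. GDERIV f x :> g x"
    and "\<And>x y. norm (g y - g x) \<le> L * norm (y - x)"
  shows "f (x - t *\<^sub>R g x) \<le> f x - (2 - t * L) * t / 2 * (norm (g x))\<^sup>2"
  using smooth_quadratic_upper_bound[OF assms, of "x - t *\<^sub>R g x" x]
  by (simp add: power_mult_distrib dot_square_norm field_simps)
    (simp add: power2_eq_square algebra_simps)

theorem lemma4:
  fixes f :: "real ^ 'n \<Rightarrow> real"
    and L s :: real
    and \<alpha> \<beta> \<gamma> :: "nat \<Rightarrow> real"
    and x y z :: "nat \<Rightarrow> real ^ 'n"
    and xstar :: "real ^ 'n"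
    and k :: nat
  assumes "L > 0"
    and "f \<in> F1 L"
    and "is_arg_min f (\<lambda>_. True) xstar"
    and "s > 0"
    and "\<forall>j. \<alpha> j \<noteq> 0"
    and "alg_B' f s \<alpha> \<beta> \<gamma> x y z"
    and "k \<ge> 1"
    and "\<alpha> k \<ge> 1"
    and "tilde_alpha \<alpha> \<beta> \<gamma> k \<ge> 0"
  shows "\<alpha> k * tilde_alpha \<alpha> \<beta> \<gamma> k * s * (f (x k) - f xstar)
           - (tilde_alpha \<alpha> \<beta> \<gamma> k)\<^sup>2 * s\<^sup>2 / 2 * (norm (grad f (x k)))\<^sup>2
           + 1 / 2 * (norm (z (k + 1) - xstar))\<^sup>2
         \<le> tilde_alpha \<alpha> \<beta> \<gamma> k * (\<alpha> k - 1) * s *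
             ((f (x (k - 1)) - f xstar)
               - (2 - \<beta> (k - 1) * L * s) * \<beta> (k - 1) * s / 2 * (norm (grad f (x (k - 1))))\<^sup>2)
           + 1 / 2 * (norm (z k - xstar))\<^sup>2"
proof -
  define g where "g = grad f (x k)"
  define a where "a = tilde_alpha \<alpha> \<beta> \<gamma> k"
  \<comment> \<open>The upper bound for \<open>f (y k)\<close> supplied by the descent
    lemma.\<close>
  define F where "F = f (x (k - 1)) -
    (2 - \<beta> (k - 1) * L * s) * \<beta> (k - 1) * s / 2 * (norm (grad f (x (k - 1))))\<^sup>2"
  have D: "GDERIV f u :> grad f u" for u
    using assms(2) by (intro GDERIV_grad) (simp add: F1_def)
  have lip: "norm (grad f v - grad f u) \<le> L * norm (v - u)" for u v
    using assms(2) by (simp add: F1_def)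
  have conv: "convex_on UNIV f"
    using assms(2) by (simp add: F1_def)
  \<comment> \<open>Truncated subtraction is exact since \<open>k \<ge> 1\<close>, so the recursion
    at index \<open>k - 1\<close> describes \<open>y k\<close> and \<open>x k\<close>.\<close>
  have k: "k - 1 + 1 = k" using assms(7) by simp
  have yk: "y k = x (k - 1) - (\<beta> (k - 1) * s) *\<^sub>R grad f (x (k - 1))"
    and xk: "x k = (1 / \<alpha> k) *\<^sub>R z k + (1 - 1 / \<alpha> k) *\<^sub>R y k"
    using assms(6) k unfolding alg_B'_def by metis+
  have zk: "z (k + 1) = z k - (a * s) *\<^sub>R g"
    using assms(6) unfolding alg_B'_def a_def g_def by blast
  have "\<alpha> k *\<^sub>R x k = z k + (\<alpha> k - 1) *\<^sub>R y k"
    using assms(8) by (simp add: xk scaleR_add_right right_diff_distrib)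
  then have "z k = \<alpha> k *\<^sub>R x k - (\<alpha> k - 1) *\<^sub>R y k" by simp
  then have split: "z k - xstar = (x k - xstar) + (\<alpha> k - 1) *\<^sub>R (x k - y k)"
    by (simp add: algebra_simps)
  have fstar: "f (x k) - f xstar \<le> g \<bullet> (x k - xstar)"
    using convex_on_GDERIV_above_tangent[OF conv D, of "x k" xstar]
    by (simp add: g_def inner_diff_right)
  have "f (y k) \<le> F"
    using gradient_step_descent[OF D lip, of "x (k - 1)" "\<beta> (k - 1) * s"]
    by (simp add: yk F_def ac_simps)
  then have "f (x k) - F \<le> g \<bullet> (x k - y k)"
    using convex_on_GDERIV_above_tangent[OF conv D, of "x k" "y k"]
    by (simp add: g_def inner_diff_right)
  \<comment> \<open>Here \<open>\<alpha> k \<ge> 1\<close> makes the weight nonnegative.\<close>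
  then have "(\<alpha> k - 1) * (f (x k) - F) \<le> (\<alpha> k - 1) * (g \<bullet> (x k - y k))"
    using assms(8) by (intro mult_left_mono) auto
  with fstar have "\<alpha> k * (f (x k) - f xstar) - (\<alpha> k - 1) * (F - f xstar) \<le> g \<bullet> (z k - xstar)"
    unfolding split by (simp add: inner_add_right algebra_simps)
  then have main: "a * s * (\<alpha> k * (f (x k) - f xstar) - (\<alpha> k - 1) * (F - f xstar))
      \<le> a * s * (g \<bullet> (z k - xstar))"
    using assms(4,9) by (intro mult_left_mono) (auto simp: a_def)
  have "z (k + 1) - xstar = (z k - xstar) - (a * s) *\<^sub>R g"
    unfolding zk by simp
  then have "(norm (z (k + 1) - xstar))\<^sup>2 = (norm (z k - xstar))\<^sup>2
      - 2 * (a * s * (g \<bullet> (z k - xstar))) + a\<^sup>2 * s\<^sup>2 * (norm g)\<^sup>2"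
    by (simp only: power2_norm_eq_inner)
      (simp add: inner_diff_left inner_diff_right inner_commute power2_eq_square algebra_simps)
  \<comment> \<open>Adding \<open>main\<close> to half of the expansion cancels the inner
    product.\<close>
  with main have "\<alpha> k * a * s * (f (x k) - f xstar) - a\<^sup>2 * s\<^sup>2 / 2 * (norm g)\<^sup>2
      + 1 / 2 * (norm (z (k + 1) - xstar))\<^sup>2
    \<le> a * (\<alpha> k - 1) * s * (F - f xstar) + 1 / 2 * (norm (z k - xstar))\<^sup>2"
    by (simp add: algebra_simps)
  moreover have "F - f xstar = (f (x (k - 1)) - f xstar) -
    (2 - \<beta> (k - 1) * L * s) * \<beta> (k - 1) * s / 2 * (norm (grad f (x (k - 1))))\<^sup>2"
    by (simp add: F_def)
  ultimately show ?thesis by (simp only: a_def g_def)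
qed

end
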